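(* Let $T$ be a graph and let $u_1,\dots,u_k$ be distinct vertices of $T$, for some $k\geq 1$. For each $i=1,\dots,k$ let $G_i$ be a rooted graph with root $r_i$, and set $$Q_i=PG_i-x\,P(G_i-r_i),\qquad R_i=P(G_i-r_i).$$ Then for any signature $(a_1,\dots,a_k)$ of positive integers, $$P\,T(u_1\!=\!r_1)G_1^{(a_1)}\cdots(u_k\!=\!r_k)G_k^{(a_k)}=\sum_{I\subseteq\{1,\dots,k\}} P\Bigl(T-\textstyle\sum_{i\in I}u_i\Bigr)\prod_{j\in I}a_j\prod_{l\in I}Q_l\prod_{m=1}^k R_m^{\,a_m-|\{m\}\cap I|}.$$
   Context: For a graph $H$, $PH$ (or $P(H)$) denotes the characteristic polynomial of the adjacency matrix of $H$ in the variable $x$. For a rooted graph $G$ with root $r$ and integer $a\geq1$, $G^{(a)}$ is the graph obtained from $a$ vertex-disjoint copies of $G$ by identifying all their roots into one vertex, again called the root $r$. For vertex-disjoint graphs $T,H_1,\dots,H_k$, distinct vertices $u_1,\dots,u_k$ of $T$ and vertices $v_i$ of $H_i$, the multiple coalescence $T(u_1\!=\!v_1)H_1\cdots(u_k\!=\!v_k)H_k$ is the graph obtained from the disjoint union $T\cup H_1\cup\cdots\cup H_k$ by identifying $u_i$ with $v_i$ for each $i$. The notation $T-\sum_{i\in I}u_i$ denotes the graph obtained from $T$ by deleting the vertices $u_i$, $i\in I$, together with their incident edges (for $I=\emptyset$ it is $T$ itself). $G-r$ denotes deletion of vertex $r$. *)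

theory Defs
  imports "Graph_Theory.Pair_Digraph" "Jordan_Normal_Form.Char_Poly"
begin

text \<open>
  Graphs are finite simple undirected graphs, i.e. values \<open>G\<close> with \<^term>\<open>pair_graph G\<close>;
  each undirected edge is present as two opposite arcs. The graph without vertices is
  allowed; its characteristic polynomial is 1.
\<close>

definition adjacency_mat :: "'a pair_pre_digraph \<Rightarrow> 'a list \<Rightarrow> int mat" where
  "adjacency_mat G vs = mat (length vs) (length vs) (\<lambda>(i, j). of_bool ((vs ! i, vs ! j) \<in> parcs G))"

text \<open>
  The choice of the enumeration is immaterial, see \<open>graph_char_poly_eq\<close> below.
\<close>

definition graph_char_poly :: "'a pair_pre_digraph \<Rightarrow> int poly" where
  "graph_char_poly G = char_poly (adjacency_mat G (SOME vs. distinct vs \<and> set vs = pverts G))"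

definition del_verts :: "'a pair_pre_digraph \<Rightarrow> 'a set \<Rightarrow> 'a pair_pre_digraph" where
  "del_verts G S = \<lparr> pverts = pverts G - S, parcs = {(x, y) \<in> parcs G. x \<notin> S \<and> y \<notin> S} \<rparr>"

definition disjoint_Union :: "'i set \<Rightarrow> ('i \<Rightarrow> 'a pair_pre_digraph) \<Rightarrow> ('i \<times> 'a) pair_pre_digraph" where
  "disjoint_Union I H =
     \<lparr> pverts = (SIGMA i : I. pverts (H i)),
       parcs = {((i, x), (i, y)) | i x y. i \<in> I \<and> (x, y) \<in> parcs (H i)} \<rparr>"

definition disjoint_union :: "'a pair_pre_digraph \<Rightarrow> 'b pair_pre_digraph \<Rightarrow> ('a + 'b) pair_pre_digraph" where
  "disjoint_union G H =
     \<lparr> pverts = pverts G <+> pverts H,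
       parcs = map_prod Inl Inl ` parcs G \<union> map_prod Inr Inr ` parcs H \<rparr>"

text \<open>
  The quotient of a graph in which exactly the vertices with the same image under \<open>f\<close>
  are identified.
\<close>

definition identify :: "('a \<Rightarrow> 'b) \<Rightarrow> 'a pair_pre_digraph \<Rightarrow> 'b pair_pre_digraph" where
  "identify f G = \<lparr> pverts = f ` pverts G, parcs = map_prod f f ` parcs G \<rparr>"

text \<open>
  \<open>rooted_power G r a\<close> is \<open>G\<^sup>(\<^sup>a\<^sup>)\<close> for the graph \<open>G\<close> with root \<open>r\<close> and \<open>a \<ge> 1\<close>.
  The copies are numbered from 0, and the roots of all copies are merged into the one of copy 0.
\<close>

definition rooted_power_root :: "'a \<Rightarrow> nat \<times> 'a" where
  "rooted_power_root r = (0, r)"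

definition rooted_power :: "'a pair_pre_digraph \<Rightarrow> 'a \<Rightarrow> nat \<Rightarrow> (nat \<times> 'a) pair_pre_digraph" where
  "rooted_power G r a =
     identify (\<lambda>(c, x). if x = r then rooted_power_root r else (c, x)) (disjoint_Union {..<a} (\<lambda>_. G))"

text \<open>
  \<open>coalescence T I u H v\<close> identifies the vertex \<open>u i\<close> of \<open>T\<close> with the vertex \<open>v i\<close> of \<open>H i\<close>,
  for all \<open>i \<in> I\<close>. The graphs are made vertex-disjoint by tagging; the merged
  vertex is represented by \<open>u i\<close>.
\<close>

definition coalescence ::
  "'a pair_pre_digraph \<Rightarrow> 'i set \<Rightarrow> ('i \<Rightarrow> 'a) \<Rightarrow> ('i \<Rightarrow> 'b pair_pre_digraph) \<Rightarrow> ('i \<Rightarrow> 'b)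
     \<Rightarrow> ('a + 'i \<times> 'b) pair_pre_digraph" where
  "coalescence T I u H v =
     identify (case_sum Inl (\<lambda>(i, x). if x = v i then Inl (u i) else Inr (i, x)))
       (disjoint_union T (disjoint_Union I H))"

lemma pair_graph_iff:
  "pair_graph G \<longleftrightarrow> finite (pverts G) \<and> parcs G \<subseteq> pverts G \<times> pverts G \<and> sym (parcs G) \<and> irrefl (parcs G)"
proof
  assume "pair_graph G"
  then interpret pair_graph G .
  show "finite (pverts G) \<and> parcs G \<subseteq> pverts G \<times> pverts G \<and> sym (parcs G) \<and> irrefl (parcs G)"
    using pair_finite_verts pair_sym_arcs
    by (auto simp: symmetric_def irrefl_def dest: in_arcsD1 in_arcsD2 pair_no_loops)
next
  assume *: "finite (pverts G) \<and> parcs G \<subseteq> pverts G \<times> pverts G \<and> sym (parcs G) \<and> irrefl (parcs G)"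
  then have "finite (parcs G)" by (meson finite_SigmaI finite_subset)
  with * show "pair_graph G"
    by unfold_locales (auto simp: symmetric_def irrefl_def)
qed

lemma graph_char_poly_eq:
  assumes "distinct vs" and "set vs = pverts G"
  shows "graph_char_poly G = char_poly (adjacency_mat G vs)"
proof -
  define ws where "ws = (SOME vs. distinct vs \<and> set vs = pverts G)"
  have ws: "distinct ws \<and> set ws = pverts G"
    using someI[where x = vs and P = "\<lambda>vs. distinct vs \<and> set vs = pverts G"] assms
    by (simp add: ws_def)
  define n where "n = length vs"
  have len: "length ws = n" using ws assms distinct_card n_def by metis
  have "mset ws = mset vs" using ws assms by (metis set_eq_iff_mset_eq_distinct)
  then obtain p where p: "p permutes {..<length vs}" "permute_list p vs = ws"
    using mset_eq_permutation by metis
  have p0: "p permutes {0..<n}" using p(1) by (simp add: n_def lessThan_atLeast0)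
  have pn: "p i < n" if "i < n" for i using p0 that permutes_in_image[of p "{0..<n}" i] by simp
  have ws_nth: "ws ! i = vs ! p i" if "i < n" for i
    using p that permute_list_nth[of p vs i] by (simp add: n_def)
  have pinj: "p i = p j \<longleftrightarrow> i = j" for i j using permutes_inj[OF p0] by (simp add: inj_eq)
  define A where "A = char_poly_matrix (adjacency_mat G vs)"
  have A: "A \<in> carrier_mat n n" unfolding A_def adjacency_mat_def n_def by auto
  define B where "B = mat n n (\<lambda>(i, j). A $$ (p i, j))"
  have B: "B \<in> carrier_mat n n" by (simp add: B_def)
  have "char_poly_matrix (adjacency_mat G ws) =
      transpose_mat (mat n n (\<lambda>(i, j). transpose_mat B $$ (p i, j)))"
    by (rule eq_matI)
      (auto simp: char_poly_matrix_def adjacency_mat_def A_def B_def len ws_nth pn pinj n_def[symmetric])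
  also have "det \<dots> = det (mat n n (\<lambda>(i, j). transpose_mat B $$ (p i, j)))"
    by (rule det_transpose) auto
  also have "\<dots> = signof p * det (transpose_mat B)"
    by (rule det_permute_rows[OF _ p0]) (use B in auto)
  also have "det (transpose_mat B) = det B" by (rule det_transpose[OF B])
  also have "det B = signof p * det A" unfolding B_def by (rule det_permute_rows[OF A p0])
  finally have "char_poly (adjacency_mat G ws) = char_poly (adjacency_mat G vs)"
    by (simp add: char_poly_def A_def sign_def)
  then show ?thesis by (simp add: graph_char_poly_def ws_def)
qed

lemma pair_graph_del_verts: "pair_graph G \<Longrightarrow> pair_graph (del_verts G S)"
  by (auto simp: pair_graph_iff del_verts_def sym_def irrefl_def)

lemma map_prod_image_Collect:
  "map_prod f f ` {(g i x, g i y) | i x y. P i x y} = {(f (g i x), f (g i y)) | i x y. P i x y}"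
  by force

lemma image_Sigma_Collect: "f ` (SIGMA i : I. A i) = {f (i, x) | i x. i \<in> I \<and> x \<in> A i}"
  by blast

lemma pair_graph_rooted_power:
  assumes G: "pair_graph G"
  shows "pair_graph (rooted_power G r a)"
proof -
  let ?P = "rooted_power G r a"
  let ?f = "\<lambda>c x. if x = r then rooted_power_root r else (c, x)"
  have arcs: "parcs ?P = {(?f c x, ?f c y) | c x y. c < a \<and> (x, y) \<in> parcs G}"
    using map_prod_image_Collect[of "case_prod ?f" Pair "\<lambda>c x y. c < a \<and> (x, y) \<in> parcs G"]
    by (simp add: rooted_power_def identify_def disjoint_Union_def)
  have verts: "pverts ?P = {?f c x | c x. c < a \<and> x \<in> pverts G}"
    by (simp add: rooted_power_def identify_def disjoint_Union_def image_Sigma_Collect)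
  have "finite (pverts ?P)"
    using G unfolding rooted_power_def identify_def disjoint_Union_def
    by (simp add: pair_graph_iff)
  moreover have "parcs ?P \<subseteq> pverts ?P \<times> pverts ?P"
    using G unfolding arcs verts pair_graph_iff by blast
  moreover have "sym (parcs ?P)"
    using G unfolding arcs pair_graph_iff sym_def by blast
  moreover have "irrefl (parcs ?P)"
  proof -
    have "?f c x \<noteq> ?f c y" if "(x, y) \<in> parcs G" for c x y
      using that G by (cases "x = y") (auto simp: pair_graph_iff irrefl_def rooted_power_root_def)
    then show ?thesis unfolding arcs irrefl_def by blast
  qed
  ultimately show ?thesis by (simp add: pair_graph_iff)
qed

lemma rooted_power_root_in_pverts:
  "r \<in> pverts G \<Longrightarrow> a \<ge> 1 \<Longrightarrow> rooted_power_root r \<in> pverts (rooted_power G r a)"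
  unfolding rooted_power_def identify_def disjoint_Union_def
  by (auto intro!: image_eqI[of _ _ "(0, r)"])

lemma pair_graph_coalescence:
  assumes T: "pair_graph T" and I: "finite I" and H: "\<And>i. i \<in> I \<Longrightarrow> pair_graph (H i)"
  shows "pair_graph (coalescence T I u H v)"
proof -
  let ?C = "coalescence T I u H v"
  let ?f = "case_sum Inl (\<lambda>(i, x). if x = v i then Inl (u i) else Inr (i, x))"
  have arcs: "parcs ?C = map_prod Inl Inl ` parcs T
      \<union> {(?f (Inr (i, x)), ?f (Inr (i, y))) | i x y. i \<in> I \<and> (x, y) \<in> parcs (H i)}" (is "?L = ?R")
  proof -
    have "?L = map_prod ?f ?f ` map_prod Inl Inl ` parcs T \<union> map_prod ?f ?f ` map_prod Inr Inr `
        {((i, x), (i, y)) | i x y. i \<in> I \<and> (x, y) \<in> parcs (H i)}"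
      by (simp add: coalescence_def identify_def disjoint_union_def disjoint_Union_def image_Un)
    also have "map_prod ?f ?f ` map_prod Inl Inl ` parcs T = map_prod Inl Inl ` parcs T"
      by (simp add: image_image map_prod_def split_beta)
    also have "map_prod ?f ?f ` map_prod Inr Inr `
          {((i, x), (i, y)) | i x y. i \<in> I \<and> (x, y) \<in> parcs (H i)}
        = {(?f (Inr (i, x)), ?f (Inr (i, y))) | i x y. i \<in> I \<and> (x, y) \<in> parcs (H i)}"
      by (simp only: map_prod_image_Collect[where f = Inr and g = Pair]
          map_prod_image_Collect[where f = ?f and g = "\<lambda>i x. Inr (i, x)"])
    finally show ?thesis .
  qed
  have verts: "pverts ?C = Inl ` pverts T \<union> {?f (Inr (i, x)) | i x. i \<in> I \<and> x \<in> pverts (H i)}"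
  proof -
    have "pverts ?C = ?f ` Inl ` pverts T \<union> ?f ` Inr ` (SIGMA i : I. pverts (H i))"
      by (simp add: coalescence_def identify_def disjoint_union_def disjoint_Union_def
          Plus_def image_Un)
    also have "?f ` Inl ` pverts T = Inl ` pverts T" by (simp add: image_image)
    also have "?f ` Inr ` (SIGMA i : I. pverts (H i))
        = {?f (Inr (i, x)) | i x. i \<in> I \<and> x \<in> pverts (H i)}" 
      by (simp only: image_Sigma_Collect) blast
    finally show ?thesis .
  qed
  have "finite (pverts ?C)"
    using T I H unfolding coalescence_def identify_def disjoint_union_def disjoint_Union_def
    by (auto simp: pair_graph_iff)
  moreover have "parcs ?C \<subseteq> pverts ?C \<times> pverts ?C"
  proof -
    have "map_prod Inl Inl ` parcs T \<subseteq> pverts ?C \<times> pverts ?C"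
      using T unfolding verts by (auto simp: pair_graph_iff)
    moreover have "?f (Inr (i, x)) \<in> pverts ?C \<and> ?f (Inr (i, y)) \<in> pverts ?C"
      if "i \<in> I" "(x, y) \<in> parcs (H i)" for i x y
    proof -
      have "x \<in> pverts (H i)" "y \<in> pverts (H i)" using that H[of i] by (auto simp: pair_graph_iff)
      then show ?thesis using that unfolding verts by blast
    qed
    ultimately show ?thesis unfolding arcs by blast
  qed
  moreover have "sym (parcs ?C)"
  proof (rule symI)
    fix a b assume "(a, b) \<in> parcs ?C"
    then consider x y where "(x, y) \<in> parcs T" "a = Inl x" "b = Inl y"
      | i x y where "i \<in> I" "(x, y) \<in> parcs (H i)" "a = ?f (Inr (i, x))" "b = ?f (Inr (i, y))"
      unfolding arcs by auto
    then show "(b, a) \<in> parcs ?C"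
    proof cases
      case 1
      then have "(y, x) \<in> parcs T" using T by (auto simp: pair_graph_iff dest: symD)
      with 1 show ?thesis unfolding arcs by force
    next
      case 2
      then have "(y, x) \<in> parcs (H i)" using H by (auto simp: pair_graph_iff dest: symD)
      with 2 show ?thesis unfolding arcs by blast
    qed
  qed
  moreover have "irrefl (parcs ?C)"
  proof -
    have "?f (Inr (i, x)) \<noteq> ?f (Inr (i, y))" if "i \<in> I" "(x, y) \<in> parcs (H i)" for i x y
      using that H[of i] by (cases "x = y") (auto simp: pair_graph_iff irrefl_def)
    moreover have "x \<noteq> y" if "(x, y) \<in> parcs T" for x y
      using that T by (auto simp: pair_graph_iff irrefl_def)
    ultimately show ?thesis unfolding arcs irrefl_def by blast
  qed
  ultimately show ?thesis by (simp add: pair_graph_iff)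
qed

end

theory Submission
  imports Defs
begin

text \<open>
  Write \<open>PG\<close> as the determinant of the kernel \<open>x I - A\<close> indexed by the vertex set. If \<open>A\<close> and \<open>B\<close> share
  only the vertex \<open>w\<close> and no edge joins the rest of \<open>A\<close> to the rest of \<open>B\<close>, splitting the row of \<open>w\<close>
  into its part in \<open>A\<close> and its part in \<open>B - w\<close> makes both summands block triangular, which gives
  \<open>P(A \<union> B) = PA P(B - w) + P(A - w) (PB - x P(B - w))\<close>. Iterating this at the root shows that
  \<open>G\<^sup>(\<^sup>a\<^sup>)\<close> has the data \<open>R\<^sup>a\<close> and \<open>a Q R\<^sup>a\<^sup>-\<^sup>1\<close> in place of \<open>R\<close> and \<open>Q\<close>. Iterating it over the
  vertices \<open>u\<^sub>i\<close> of \<open>T\<close> gives the sum over \<open>I\<close>: a member of \<open>I\<close> marks the summand that deletes \<open>u\<^sub>i\<close>.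
\<close>

section \<open>Determinants indexed by a finite set\<close>

text \<open>Indexing by a vertex set instead of \<open>{0..<n}\<close> turns every principal minor
  into the same kernel \<open>M\<close> on a smaller set. Deleting vertices and cutting a graph into
  pieces then need no index arithmetic. The enumeration chosen by \<open>SOME\<close> is harmless by
  \<open>det_mat_reorder\<close>.\<close>

definition set_det :: "'v set \<Rightarrow> ('v \<Rightarrow> 'v \<Rightarrow> 'r) \<Rightarrow> 'r :: idom" where
  "set_det V M = (let vs = (SOME vs. distinct vs \<and> set vs = V)
     in det (mat (length vs) (length vs) (\<lambda>(i, j). M (vs ! i) (vs ! j))))"

text \<open>Reordering permutes rows and columns by the same permutation, so its sign enters twice
  and cancels. The columns are permuted as rows of the transpose.\<close>

lemma det_mat_reorder:
  assumes "mset ws = mset vs"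
  shows "det (mat (length ws) (length ws) (\<lambda>(i, j). M (ws ! i) (ws ! j) :: 'r :: idom))
       = det (mat (length vs) (length vs) (\<lambda>(i, j). M (vs ! i) (vs ! j)))"
proof -
  obtain p where p: "p permutes {..<length vs}" "permute_list p vs = ws"
    using assms mset_eq_permutation by metis
  define n where "n = length vs"
  have p0: "p permutes {0..<n}" using p(1) by (simp add: n_def lessThan_atLeast0)
  have len: "length ws = n" using p(2) by (auto simp: n_def)
  have pn: "p i < n" if "i < n" for i using p0 that permutes_in_image[of p "{0..<n}" i] by simp
  have ws_nth: "ws ! i = vs ! p i" if "i < n" for i
    using p that permute_list_nth[of p vs i] by (simp add: n_def)
  define A where "A = mat n n (\<lambda>(i, j). M (vs ! i) (vs ! j))"
  have A: "A \<in> carrier_mat n n" by (simp add: A_def)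
  define B where "B = mat n n (\<lambda>(i, j). A $$ (p i, j))"
  have B: "B \<in> carrier_mat n n" by (simp add: B_def)
  have "mat n n (\<lambda>(i, j). M (ws ! i) (ws ! j)) =
      transpose_mat (mat n n (\<lambda>(i, j). transpose_mat B $$ (p i, j)))"
    by (rule eq_matI) (auto simp: A_def B_def ws_nth pn)
  also have "det \<dots> = det (mat n n (\<lambda>(i, j). transpose_mat B $$ (p i, j)))"
    by (rule det_transpose) auto
  also have "\<dots> = signof p * det (transpose_mat B)"
    by (rule det_permute_rows[OF _ p0]) (use B in auto)
  also have "det (transpose_mat B) = det B" by (rule det_transpose[OF B])
  also have "det B = signof p * det A" unfolding B_def by (rule det_permute_rows[OF A p0])
  finally show ?thesis by (simp add: A_def len n_def[symmetric] sign_def)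
qed

lemma set_det_eq_det:
  assumes "distinct vs" and "set vs = V"
  shows "set_det V M = det (mat (length vs) (length vs) (\<lambda>(i, j). M (vs ! i) (vs ! j)))"
proof -
  define ws where "ws = (SOME vs. distinct vs \<and> set vs = V)"
  have "distinct ws \<and> set ws = V"
    unfolding ws_def by (rule someI[of _ vs]) (use assms in simp)
  then have "mset ws = mset vs" using assms by (metis set_eq_iff_mset_eq_distinct)
  then show ?thesis
    unfolding set_det_def Let_def ws_def[symmetric] by (rule det_mat_reorder)
qed

lemma set_det_cong:
  assumes "finite V" and "\<And>x y. x \<in> V \<Longrightarrow> y \<in> V \<Longrightarrow> M x y = N x y"
  shows "set_det V M = set_det V N"
proof -
  obtain vs where vs: "distinct vs" "set vs = V" using finite_distinct_list[OF assms(1)] by blast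
  have "mat (length vs) (length vs) (\<lambda>(i, j). M (vs ! i) (vs ! j))
      = mat (length vs) (length vs) (\<lambda>(i, j). N (vs ! i) (vs ! j))"
    by (rule eq_matI) (use vs assms(2) nth_mem in auto)
  then show ?thesis by (simp add: set_det_eq_det[OF vs])
qed

lemma set_det_image:
  assumes "finite V" and "inj_on f V"
  shows "set_det (f ` V) M = set_det V (\<lambda>x y. M (f x) (f y))"
proof -
  obtain vs where vs: "distinct vs" "set vs = V" using finite_distinct_list[OF assms(1)] by blast
  have *: "distinct (map f vs)" "set (map f vs) = f ` V" using vs assms by (auto simp: distinct_map)
  have "mat (length vs) (length vs) (\<lambda>(i, j). M (map f vs ! i) (map f vs ! j))
      = mat (length vs) (length vs) (\<lambda>(i, j). M (f (vs ! i)) (f (vs ! j)))"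
    by (rule eq_matI) auto
  then show ?thesis by (simp only: set_det_eq_det[OF vs] set_det_eq_det[OF *] length_map)
qed

lemma set_det_empty [simp]: "set_det {} M = 1"
  by (subst set_det_eq_det[of "[]"]) auto

lemma set_det_singleton [simp]: "set_det {w} M = M w w"
  by (subst set_det_eq_det[of "[w]"]) (auto simp: det_single)

text \<open>Linearity of the determinant in the row of \<open>w\<close>, read off the Leibniz
  formula: each product contains exactly one factor from that row.\<close>

lemma set_det_row_add:
  assumes "finite V" and w: "w \<in> V"
    and row: "\<And>y. y \<in> V \<Longrightarrow> M w y = M1 w y + M2 w y"
    and other: "\<And>x y. x \<in> V \<Longrightarrow> x \<noteq> w \<Longrightarrow> y \<in> V \<Longrightarrow> M1 x y = M x y"
      "\<And>x y. x \<in> V \<Longrightarrow> x \<noteq> w \<Longrightarrow> y \<in> V \<Longrightarrow> M2 x y = M x y"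
  shows "set_det V M = set_det V M1 + set_det V M2"
proof -
  obtain ws where ws: "distinct ws" "set ws = V - {w}"
    using finite_distinct_list[of "V - {w}"] assms(1) by auto
  \<comment> \<open>With \<open>w\<close> listed first, its row is row 0, so its factor is the first
    one of each Leibniz product; all later indices belong to vertices other than
    \<open>w\<close>.\<close>
  define vs where "vs = w # ws"
  define m where "m = length ws"
  have vs: "distinct vs" "set vs = V" using ws w by (auto simp: vs_def)
  have len: "length vs = Suc m" by (simp add: vs_def m_def)
  have expand: "set_det V N = (\<Sum>p | p permutes {0..<Suc m}. signof p *
      (N w (vs ! p 0) * (\<Prod>i = Suc 0..<Suc m. N (vs ! i) (vs ! p i))))" for N
  proof -
    have "set_det V N = (\<Sum>p | p permutes {0..<Suc m}. signof p *
        (\<Prod>i = 0..<Suc m. mat (Suc m) (Suc m) (\<lambda>(i, j). N (vs ! i) (vs ! j)) $$ (i, p i)))"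
      unfolding set_det_eq_det[OF vs] len by (rule det_def') simp
    also have "\<dots> = (\<Sum>p | p permutes {0..<Suc m}. signof p *
        (\<Prod>i = 0..<Suc m. N (vs ! i) (vs ! p i)))"
    proof (intro sum.cong refl arg_cong2[of _ _ _ _ "(*)"] prod.cong)
      fix p i assume "p \<in> {p. p permutes {0..<Suc m}}" "i \<in> {0..<Suc m}"
      then have "p i \<in> {0..<Suc m}" "i < Suc m" by (auto simp: permutes_in_image)
      then show "mat (Suc m) (Suc m) (\<lambda>(i, j). N (vs ! i) (vs ! j)) $$ (i, p i)
          = N (vs ! i) (vs ! p i)" by simp
    qed
    also have "\<dots> = (\<Sum>p | p permutes {0..<Suc m}. signof p *
      (N w (vs ! p 0) * (\<Prod>i = Suc 0..<Suc m. N (vs ! i) (vs ! p i))))"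
      by (subst prod.atLeast_Suc_lessThan) (auto simp: vs_def)
    finally show ?thesis .
  qed
  have "set_det V M = (\<Sum>p | p permutes {0..<Suc m}.
      signof p * (M1 w (vs ! p 0) * (\<Prod>i = Suc 0..<Suc m. M1 (vs ! i) (vs ! p i)))
    + signof p * (M2 w (vs ! p 0) * (\<Prod>i = Suc 0..<Suc m. M2 (vs ! i) (vs ! p i))))"
    unfolding expand[of M]
  proof (rule sum.cong[OF refl])
    fix p assume "p \<in> {p. p permutes {0..<Suc m}}"
    then have p: "p i < Suc m" if "i < Suc m" for i using that permutes_in_image[of p "{0..<Suc m}" i] by simp
    have mem: "vs ! p i \<in> V" if "i < Suc m" for i
      using p[of i] that vs(2) len nth_mem[of "p i" vs] by auto
    have "vs ! i \<in> V - {w}" if "i \<in> {Suc 0..<Suc m}" for i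
    proof (cases i)
      case (Suc l)
      then show ?thesis using that ws nth_mem[of l ws] by (auto simp: vs_def m_def)
    qed (use that in simp)
    then have "(\<Prod>i = Suc 0..<Suc m. M1 (vs ! i) (vs ! p i))
          = (\<Prod>i = Suc 0..<Suc m. M (vs ! i) (vs ! p i))"
      and "(\<Prod>i = Suc 0..<Suc m. M2 (vs ! i) (vs ! p i))
          = (\<Prod>i = Suc 0..<Suc m. M (vs ! i) (vs ! p i))"
      using mem other by (auto intro!: prod.cong)
    then show "signof p * (M w (vs ! p 0) * (\<Prod>i = Suc 0..<Suc m. M (vs ! i) (vs ! p i)))
      = signof p * (M1 w (vs ! p 0) * (\<Prod>i = Suc 0..<Suc m. M1 (vs ! i) (vs ! p i)))
        + signof p * (M2 w (vs ! p 0) * (\<Prod>i = Suc 0..<Suc m. M2 (vs ! i) (vs ! p i)))"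
      using row[OF mem[of 0]] by (simp add: algebra_simps)
  qed
  then show ?thesis by (simp add: sum.distrib expand)
qed

text \<open>Only the entries from \<open>A\<close> to \<open>B\<close> have to vanish. The entries
  from \<open>B\<close> to \<open>A\<close> are arbitrary, so clearing part of a single row can be
  enough to reach this form.\<close>

lemma set_det_block_triangular:
  assumes "finite A" and "finite B" and "A \<inter> B = {}"
    and "\<And>x y. x \<in> A \<Longrightarrow> y \<in> B \<Longrightarrow> M x y = 0"
  shows "set_det (A \<union> B) M = set_det A M * set_det B M"
proof -
  obtain xs ys where xs: "distinct xs" "set xs = A" and ys: "distinct ys" "set ys = B"
    using finite_distinct_list assms(1,2) by metis
  have zs: "distinct (xs @ ys)" "set (xs @ ys) = A \<union> B" using xs ys assms(3) by auto
  let ?m = "length xs" and ?n = "length ys"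
  let ?A = "mat ?m ?m (\<lambda>(i, j). M (xs ! i) (xs ! j))"
  let ?C = "mat ?n ?m (\<lambda>(i, j). M (ys ! i) (xs ! j))"
  let ?D = "mat ?n ?n (\<lambda>(i, j). M (ys ! i) (ys ! j))"
  have zero: "M (xs ! i) (ys ! j) = 0" if "i < ?m" "j < ?n" for i j
    using that assms(4) xs(2) ys(2) nth_mem by blast
  have "mat (length (xs @ ys)) (length (xs @ ys)) (\<lambda>(i, j). M ((xs @ ys) ! i) ((xs @ ys) ! j))
      = four_block_mat ?A (0\<^sub>m ?m ?n) ?C ?D"
    by (rule eq_matI) (auto simp: nth_append zero)
  also have "det \<dots> = det ?A * det ?D"
    by (rule det_four_block_mat_upper_right_zero) auto
  finally show ?thesis
    by (simp only: set_det_eq_det[OF xs] set_det_eq_det[OF ys] set_det_eq_det[OF zs])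
qed

section \<open>Gluing kernels at cut vertices\<close>

text \<open>
  For \<open>w \<in> V\<close> this is the determinant with the diagonal entry at \<open>w\<close> replaced by 0; for
  \<open>M = x I - A\<close> it is the polynomial \<open>Q\<close> of the graph rooted at \<open>w\<close>.
\<close>

definition rooted_det :: "'v set \<Rightarrow> 'v \<Rightarrow> ('v \<Rightarrow> 'v \<Rightarrow> 'r) \<Rightarrow> 'r :: idom" where
  "rooted_det V w M = set_det V M - M w w * set_det (V - {w}) M"

lemma set_det_one_sum:
  assumes fin: "finite A" "finite B" and AB: "A \<inter> B = {w}"
    and zero: "\<And>x y. x \<in> A - {w} \<Longrightarrow> y \<in> B - {w} \<Longrightarrow> M x y = 0 \<and> M y x = 0"
  shows "set_det (A \<union> B) M
       = set_det A M * set_det (B - {w}) M + set_det (A - {w}) M * rooted_det B w M"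
proof -
  have w: "w \<in> A" "w \<in> B" using AB by auto
  \<comment> \<open>\<open>M1\<close> keeps the part of the row of \<open>w\<close> inside
    \<open>A\<close>, including the diagonal entry, and \<open>M2\<close> keeps the part in
    \<open>B - {w}\<close>. For \<open>M1\<close> the rows of \<open>A\<close> vanish on
    \<open>B - {w}\<close>; for \<open>M2\<close> the rows of \<open>B\<close> vanish on
    \<open>A - {w}\<close>. So \<open>w\<close> belongs to the block \<open>A\<close> in the first
    case and to \<open>B\<close> in the second.\<close>
  define M1 where "M1 x y = (if x = w \<and> y \<notin> A then 0 else M x y)" for x y
  define M2 where "M2 x y = (if x = w \<and> y \<in> A then 0 else M x y)" for x y
  \<comment> \<open>On \<open>B\<close>, \<open>M2\<close> is \<open>M\<close> with the diagonal
    entry at \<open>w\<close> set to 0. \<open>M3\<close> carries what is missing: only that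
    diagonal entry in the row of \<open>w\<close>.\<close>
  define M3 where "M3 x y = (if x = w \<and> y \<noteq> w then 0 else M x y)" for x y
  have "set_det (A \<union> B) M = set_det (A \<union> B) M1 + set_det (A \<union> B) M2"
    by (rule set_det_row_add[of _ w]) (use fin w in \<open>auto simp: M1_def M2_def\<close>)
  also have "set_det (A \<union> B) M1 = set_det (A \<union> (B - {w})) M1"
    using w by (intro arg_cong2[of _ _ _ _ set_det]) auto
  also have "\<dots> = set_det A M1 * set_det (B - {w}) M1"
    by (rule set_det_block_triangular) (use fin AB zero in \<open>auto simp: M1_def\<close>)
  also have "set_det A M1 = set_det A M" by (rule set_det_cong) (use fin in \<open>auto simp: M1_def\<close>)
  also have "set_det (B - {w}) M1 = set_det (B - {w}) M"
    by (rule set_det_cong) (use fin in \<open>auto simp: M1_def\<close>)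
  also have "set_det (A \<union> B) M2 = set_det (B \<union> (A - {w})) M2"
    using w by (intro arg_cong2[of _ _ _ _ set_det]) auto
  also have "\<dots> = set_det B M2 * set_det (A - {w}) M2"
    by (rule set_det_block_triangular) (use fin AB zero in \<open>auto simp: M2_def\<close>)
  also have "set_det (A - {w}) M2 = set_det (A - {w}) M"
    by (rule set_det_cong) (use fin in \<open>auto simp: M2_def\<close>)
  also have "set_det B M2 = rooted_det B w M"
  proof -
    have "set_det B M = set_det B M2 + set_det B M3"
      by (rule set_det_row_add[of _ w]) (use fin w AB in \<open>auto simp: M2_def M3_def\<close>)
    also have "set_det B M3 = set_det ({w} \<union> (B - {w})) M3"
      using w by (intro arg_cong2[of _ _ _ _ set_det]) auto
    also have "\<dots> = set_det {w} M3 * set_det (B - {w}) M3"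
      by (rule set_det_block_triangular) (use fin in \<open>auto simp: M3_def\<close>)
    also have "set_det (B - {w}) M3 = set_det (B - {w}) M"
      by (rule set_det_cong) (use fin in \<open>auto simp: M3_def\<close>)
    finally show ?thesis by (simp add: rooted_det_def M3_def)
  qed
  finally show ?thesis by (simp add: mult.commute)
qed

lemma set_det_disjoint_UN:
  assumes "finite C" and "\<And>c. c \<in> C \<Longrightarrow> finite (B c)"
    and "\<And>c d. c \<in> C \<Longrightarrow> d \<in> C \<Longrightarrow> c \<noteq> d \<Longrightarrow> B c \<inter> B d = {}"
    and "\<And>c d x y. c \<in> C \<Longrightarrow> d \<in> C \<Longrightarrow> c \<noteq> d \<Longrightarrow> x \<in> B c \<Longrightarrow> y \<in> B d \<Longrightarrow> M x y = 0"
  shows "set_det (\<Union>c\<in>C. B c) M = (\<Prod>c\<in>C. set_det (B c) M)"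
  using assms
proof (induction C rule: finite_induct)
  case (insert c C)
  have "set_det (B c \<union> (\<Union>d\<in>C. B d)) M = set_det (B c) M * set_det (\<Union>d\<in>C. B d) M"
  proof (rule set_det_block_triangular)
    show "B c \<inter> (\<Union>d\<in>C. B d) = {}" using insert.prems(2) insert.hyps by fastforce
    show "M x y = 0" if "x \<in> B c" "y \<in> (\<Union>d\<in>C. B d)" for x y
      using insert.prems(3)[of c] insert.hyps that by fastforce
  qed (use insert in auto)
  also have "set_det (\<Union>d\<in>C. B d) M = (\<Prod>d\<in>C. set_det (B d) M)"
  proof (rule insert.IH)
    show "M x y = 0" if "i \<in> C" "j \<in> C" "i \<noteq> j" "x \<in> B i" "y \<in> B j" for i j x y
      using insert.prems(3)[of i j] that by blast
  qed (use insert.prems in auto)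
  finally show ?case using insert.hyps by simp
qed simp

text \<open>Under gluing at \<open>w\<close>, \<open>rooted_det\<close> obeys a product rule, with
  deletion of \<open>w\<close> as the multiplicative factor. Iterated over the branches
  \<open>B c\<close> around the common centre \<open>w\<close>, it gives one summand per branch, as
  for the derivative of a product.\<close>

lemma rooted_det_star:
  assumes "finite C" and "\<And>c. c \<in> C \<Longrightarrow> finite (B c)" and "\<And>c. c \<in> C \<Longrightarrow> w \<notin> B c"
    and "\<And>c d. c \<in> C \<Longrightarrow> d \<in> C \<Longrightarrow> c \<noteq> d \<Longrightarrow> B c \<inter> B d = {}"
    and "\<And>c d x y. c \<in> C \<Longrightarrow> d \<in> C \<Longrightarrow> c \<noteq> d \<Longrightarrow> x \<in> B c \<Longrightarrow> y \<in> B d \<Longrightarrow> M x y = 0"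
  shows "rooted_det (insert w (\<Union>c\<in>C. B c)) w M
       = (\<Sum>c\<in>C. rooted_det (insert w (B c)) w M * (\<Prod>d\<in>C - {c}. set_det (B d) M))"
  using assms
proof (induction C rule: finite_induct)
  \<comment> \<open>The single vertex \<open>w\<close> has \<open>rooted_det\<close> equal to
    \<open>M w w - M w w = 0\<close>, which matches the empty sum.\<close>
  case empty
  then show ?case by (simp add: rooted_det_def)
next
  case (insert c C)
  let ?U = "\<Union>d\<in>C. B d" and ?P = "\<lambda>C. \<Prod>d\<in>C. set_det (B d) M"
  have w: "w \<notin> B c" "w \<notin> ?U" using insert.prems insert.hyps by auto
  have disj: "?U \<inter> B c = {}" using insert.prems(3) insert.hyps by fastforce
  have U: "set_det ?U M = ?P C"
  proof (rule set_det_disjoint_UN)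
    show "M x y = 0" if "i \<in> C" "j \<in> C" "i \<noteq> j" "x \<in> B i" "y \<in> B j" for i j x y
      using insert.prems(4)[of i j] that by blast
  qed (use insert.prems insert.hyps in auto)
  have zero: "M x y = 0 \<and> M y x = 0" if "x \<in> ?U" "y \<in> B c" for x y
    using insert.prems(4)[of c] insert.prems(4)[of _ c] insert.hyps that by fastforce
  have "set_det (insert w ?U \<union> insert w (B c)) M =
      set_det (insert w ?U) M * set_det (insert w (B c) - {w}) M
      + set_det (insert w ?U - {w}) M * rooted_det (insert w (B c)) w M"
    by (rule set_det_one_sum) (use insert.prems insert.hyps disj w zero in auto)
  moreover have "set_det (?U \<union> B c) M = set_det ?U M * set_det (B c) M"
    by (rule set_det_block_triangular) (use insert.prems insert.hyps disj zero in auto)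
  moreover have "insert w ?U \<union> insert w (B c) = insert w (\<Union>d\<in>insert c C. B d)" by auto
  moreover have "?U \<union> B c = (\<Union>d\<in>insert c C. B d)" by auto
  \<comment> \<open>The product rule: subtract \<open>M w w\<close> times the factorisation of the
    determinant without \<open>w\<close> from the one-vertex gluing formula; the subtracted term
    joins the determinant of \<open>insert w ?U\<close>.\<close>
  ultimately have "rooted_det (insert w (\<Union>d\<in>insert c C. B d)) w M =
      rooted_det (insert w ?U) w M * set_det (B c) M + rooted_det (insert w (B c)) w M * ?P C"
    using w by (simp add: rooted_det_def U algebra_simps)
  also have "rooted_det (insert w ?U) w M
      = (\<Sum>d\<in>C. rooted_det (insert w (B d)) w M * ?P (C - {d}))"
  proof (rule insert.IH)
    show "M x y = 0" if "i \<in> C" "j \<in> C" "i \<noteq> j" "x \<in> B i" "y \<in> B j" for i j x y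
      using insert.prems(4)[of i j] that by blast
  qed (use insert.prems in auto)
  also have "\<dots> * set_det (B c) M
      = (\<Sum>d\<in>C. rooted_det (insert w (B d)) w M * ?P (insert c C - {d}))"
    unfolding sum_distrib_right
  proof (rule sum.cong[OF refl])
    fix d assume "d \<in> C"
    then have "insert c C - {d} = insert c (C - {d})" using insert.hyps by auto
    then show "rooted_det (insert w (B d)) w M * ?P (C - {d}) * set_det (B c) M
        = rooted_det (insert w (B d)) w M * ?P (insert c C - {d})"
      using insert.hyps by simp
  qed
  finally show ?case using insert.hyps by (simp add: add.commute)
qed

text \<open>\<open>B i\<close> is the branch hanging at \<open>u i\<close>, without
  \<open>u i\<close> itself. Gluing the branches one after another gives two terms each time: one
  keeps \<open>u i\<close> in \<open>A\<close>, the other deletes it. The set \<open>S\<close>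
  records the deletions.\<close>

lemma set_det_coalescence:
  assumes "finite I" and "finite A" and "u ` I \<subseteq> A" and "inj_on u I"
    and "\<And>i. i \<in> I \<Longrightarrow> finite (B i)" and "\<And>i. i \<in> I \<Longrightarrow> A \<inter> B i = {}"
    and "\<And>i j. i \<in> I \<Longrightarrow> j \<in> I \<Longrightarrow> i \<noteq> j \<Longrightarrow> B i \<inter> B j = {}"
    and "\<And>i j x y. i \<in> I \<Longrightarrow> j \<in> I \<Longrightarrow> i \<noteq> j \<Longrightarrow> x \<in> B i \<Longrightarrow> y \<in> B j \<Longrightarrow> M x y = 0"
    and "\<And>i x y. i \<in> I \<Longrightarrow> x \<in> A - {u i} \<Longrightarrow> y \<in> B i \<Longrightarrow> M x y = 0 \<and> M y x = 0"
  shows "set_det (A \<union> (\<Union>i\<in>I. B i)) M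
       = (\<Sum>S\<in>Pow I. set_det (A - u ` S) M * (\<Prod>i\<in>S. rooted_det (insert (u i) (B i)) (u i) M)
            * (\<Prod>i\<in>I - S. set_det (B i) M))"
  using assms
\<comment> \<open>\<open>A\<close> must vary because the second term of each split applies the
  induction hypothesis to \<open>A - {u i}\<close>.\<close>
proof (induction I arbitrary: A rule: finite_induct)
  case (insert i I)
  let ?U = "\<Union>j\<in>I. B j"
  let ?q = "\<lambda>i. rooted_det (insert (u i) (B i)) (u i) M" and ?d = "\<lambda>i. set_det (B i) M"
  let ?t = "\<lambda>A I S. set_det (A - u ` S) M * (\<Prod>i\<in>S. ?q i) * (\<Prod>i\<in>I - S. ?d i)"
  have ui: "u i \<in> A" "u i \<notin> B i" "u i \<notin> ?U" "u i \<notin> u ` I"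
    using insert.prems insert.hyps by (auto simp: inj_on_def)
  have disj: "?U \<inter> B i = {}" using insert.prems(6) insert.hyps by fastforce
  have zero: "M x y = 0 \<and> M y x = 0" if "x \<in> ?U" "y \<in> B i" for x y
    using insert.prems(7)[of i] insert.prems(7)[of _ i] insert.hyps that by fastforce
  have "set_det ((A \<union> ?U) \<union> insert (u i) (B i)) M =
      set_det (A \<union> ?U) M * set_det (insert (u i) (B i) - {u i}) M
      + set_det (A \<union> ?U - {u i}) M * ?q i"
  proof (rule set_det_one_sum)
    show "(A \<union> ?U) \<inter> insert (u i) (B i) = {u i}" using ui disj insert.prems(5)[of i] by auto
    show "M x y = 0 \<and> M y x = 0"
      if "x \<in> A \<union> ?U - {u i}" "y \<in> insert (u i) (B i) - {u i}" for x y
      using that zero[of x y] insert.prems(8)[of i x y] by auto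
  qed (use insert.prems insert.hyps in auto)
  also have "insert (u i) (B i) - {u i} = B i" using ui by auto
  also have "A \<union> ?U - {u i} = (A - {u i}) \<union> ?U" using ui by auto
  also have "set_det ((A - {u i}) \<union> ?U) M = (\<Sum>S\<in>Pow I. ?t (A - {u i}) I S)"
  proof (rule insert.IH)
    show "M x y = 0" if "i \<in> I" "j \<in> I" "i \<noteq> j" "x \<in> B i" "y \<in> B j" for i j x y
      using insert.prems(7)[of i j] that by blast
    show "M x y = 0 \<and> M y x = 0" if "j \<in> I" "x \<in> (A - {u i}) - {u j}" "y \<in> B j" for j x y
      using insert.prems(8)[of j] that by blast
    show "(A - {u i}) \<inter> B j = {}" if "j \<in> I" for j using insert.prems(5)[of j] that by blast
    show "B i \<inter> B j = {}" if "i \<in> I" "j \<in> I" "i \<noteq> j" for i j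
      using insert.prems(6)[of i j] that by blast
    show "u ` I \<subseteq> (A - {u i})" using insert.prems(2) ui(4) by blast
    show "inj_on u I" using insert.prems(3) by simp
  qed (use insert.prems in auto)
  also have "set_det (A \<union> ?U) M = (\<Sum>S\<in>Pow I. ?t A I S)"
  proof (rule insert.IH)
    show "M x y = 0" if "i \<in> I" "j \<in> I" "i \<noteq> j" "x \<in> B i" "y \<in> B j" for i j x y
      using insert.prems(7)[of i j] that by blast
    show "M x y = 0 \<and> M y x = 0" if "j \<in> I" "x \<in> A - {u j}" "y \<in> B j" for j x y
      using insert.prems(8)[of j] that by blast
    show "A \<inter> B j = {}" if "j \<in> I" for j using insert.prems(5)[of j] that by blast
    show "B i \<inter> B j = {}" if "i \<in> I" "j \<in> I" "i \<noteq> j" for i j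
      using insert.prems(6)[of i j] that by blast
    show "u ` I \<subseteq> A" using insert.prems(2) ui by auto
    show "inj_on u I" using insert.prems(3) by simp
  qed (use insert.prems in auto)
  \<comment> \<open>The two terms yield the subsets of \<open>insert i I\<close>: here those without
    \<open>i\<close>, next those containing \<open>i\<close>, reindexed by
    \<open>insert i\<close>.\<close>
  also have "(\<Sum>S\<in>Pow I. ?t A I S) * ?d i = (\<Sum>S\<in>Pow I. ?t A (insert i I) S)"
    unfolding sum_distrib_right
  proof (rule sum.cong[OF refl])
    fix S assume S: "S \<in> Pow I"
    then have "insert i I - S = insert i (I - S)" "i \<notin> I - S" using insert.hyps by auto
    then show "?t A I S * ?d i = ?t A (insert i I) S"
      using insert.hyps(1) by (simp add: mult_ac)
  qed
  also have "(\<Sum>S\<in>Pow I. ?t (A - {u i}) I S) * ?q i = (\<Sum>S\<in>Pow I. ?t A (insert i I) (insert i S))"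
    unfolding sum_distrib_right
  proof (rule sum.cong[OF refl])
    fix S assume S: "S \<in> Pow I"
    then have "insert i I - insert i S = I - S" "i \<notin> S" "finite S" "A - {u i} - u ` S = A - u ` insert i S"
      using insert.hyps finite_subset by auto
    then show "?t (A - {u i}) I S * ?q i = ?t A (insert i I) (insert i S)"
      by (simp add: mult_ac)
  qed
  also have "\<dots> = (\<Sum>S\<in>insert i ` Pow I. ?t A (insert i I) S)"
    using insert.hyps by (subst sum.reindex) (auto simp: inj_on_def)
  also have "(\<Sum>S\<in>Pow I. ?t A (insert i I) S) + \<dots> = (\<Sum>S\<in>Pow (insert i I). ?t A (insert i I) S)"
    unfolding Pow_insert
    by (rule sum.union_disjoint[symmetric]) (use insert.hyps in auto)
  also have "(A \<union> ?U) \<union> insert (u i) (B i) = A \<union> (\<Union>j\<in>insert i I. B j)" using ui by auto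
  finally show ?case .
qed simp

section \<open>Characteristic polynomials of coalescences\<close>

definition graph_kernel :: "'a pair_pre_digraph \<Rightarrow> 'a \<Rightarrow> 'a \<Rightarrow> int poly" where
  "graph_kernel G x y = (if x = y then [:0, 1:] else 0) - of_bool ((x, y) \<in> parcs G)"

lemma graph_kernel_self: "pair_graph G \<Longrightarrow> graph_kernel G x x = [:0, 1:]"
  by (auto simp: graph_kernel_def pair_graph_iff irrefl_def)

lemma graph_kernel_eq_0: "x \<noteq> y \<Longrightarrow> (x, y) \<notin> parcs G \<Longrightarrow> graph_kernel G x y = 0"
  by (simp add: graph_kernel_def)

lemma graph_char_poly_eq_set_det:
  assumes "finite (pverts G)"
  shows "graph_char_poly G = set_det (pverts G) (graph_kernel G)"
proof -
  obtain vs where vs: "distinct vs" "set vs = pverts G"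
    using finite_distinct_list[OF assms] by blast
  have "char_poly_matrix (adjacency_mat G vs)
      = mat (length vs) (length vs) (\<lambda>(i, j). graph_kernel G (vs ! i) (vs ! j))"
    by (rule eq_matI)
      (auto simp: char_poly_matrix_def adjacency_mat_def graph_kernel_def
        nth_eq_iff_index_eq[OF vs(1)] one_pCons)
  then show ?thesis
    by (simp add: graph_char_poly_eq[OF vs] char_poly_def set_det_eq_det[OF vs])
qed

text \<open>Deletion leaves the arcs between the remaining vertices unchanged, so the kernel of
  \<open>G\<close> itself can stay and only the index set shrinks.\<close>

lemma graph_char_poly_del_verts:
  assumes "finite (pverts G)"
  shows "graph_char_poly (del_verts G S) = set_det (pverts G - S) (graph_kernel G)"
proof -
  have "graph_char_poly (del_verts G S) = set_det (pverts G - S) (graph_kernel (del_verts G S))"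
    using assms by (subst graph_char_poly_eq_set_det) (auto simp: del_verts_def)
  also have "\<dots> = set_det (pverts G - S) (graph_kernel G)"
    by (rule set_det_cong) (use assms in \<open>auto simp: graph_kernel_def del_verts_def\<close>)
  finally show ?thesis .
qed

section \<open>Rooted graphs and their induced copies\<close>

lemma rooted_det_graph_kernel:
  assumes "pair_graph G"
  shows "rooted_det (pverts G) w (graph_kernel G)
       = graph_char_poly G - [:0, 1:] * graph_char_poly (del_verts G {w})"
proof -
  have "finite (pverts G)" using assms by (simp add: pair_graph_iff)
  then show ?thesis
    by (simp add: rooted_det_def graph_kernel_self[OF assms] graph_char_poly_eq_set_det
        graph_char_poly_del_verts)
qed

text \<open>The arc condition is an equivalence, so \<open>f\<close> maps the subgraph of
  \<open>G\<close> induced on \<open>V\<close> isomorphically onto an induced subgraph of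
  \<open>H\<close>. This identifies the pieces of a glued graph with the original graphs.\<close>

lemma set_det_graph_embedding:
  assumes "finite V" and "inj_on f V"
    and "\<And>x y. x \<in> V \<Longrightarrow> y \<in> V \<Longrightarrow> (f x, f y) \<in> parcs H \<longleftrightarrow> (x, y) \<in> parcs G"
  shows "set_det (f ` V) (graph_kernel H) = set_det V (graph_kernel G)"
  unfolding set_det_image[OF assms(1,2)]
  by (rule set_det_cong) (use assms in \<open>auto simp: graph_kernel_def inj_on_def\<close>)

lemma rooted_det_graph_embedding:
  assumes "pair_graph G" and "pair_graph H" and "w \<in> pverts G" and inj: "inj_on f (pverts G)"
    and emb: "\<And>x y. x \<in> pverts G \<Longrightarrow> y \<in> pverts G \<Longrightarrow>
      (f x, f y) \<in> parcs H \<longleftrightarrow> (x, y) \<in> parcs G"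
  shows "rooted_det (f ` pverts G) (f w) (graph_kernel H)
       = graph_char_poly G - [:0, 1:] * graph_char_poly (del_verts G {w})"
proof -
  have fin: "finite (pverts G)" using assms(1) by (simp add: pair_graph_iff)
  have "f ` pverts G - {f w} = f ` (pverts G - {w})"
    using inj assms(3) by (auto simp: inj_on_def)
  moreover have "set_det (f ` (pverts G - {w})) (graph_kernel H)
      = set_det (pverts G - {w}) (graph_kernel G)"
    by (rule set_det_graph_embedding) (use fin inj emb in \<open>auto simp: inj_on_def\<close>)
  moreover have "set_det (f ` pverts G) (graph_kernel H) = set_det (pverts G) (graph_kernel G)"
    by (rule set_det_graph_embedding) (use fin inj emb in auto)
  ultimately show ?thesis
    by (simp add: rooted_det_def graph_kernel_self[OF assms(2)] graph_char_poly_eq_set_det[OF fin]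
        graph_char_poly_del_verts[OF fin])
qed

text \<open>The power is a star of \<open>a\<close> branches, each a copy of \<open>G\<close>
  without its root. Deleting the merged root leaves a disjoint union, whence \<open>R ^ a\<close>;
  \<open>rooted_det_star\<close> gives \<open>a\<close> equal summands.\<close>

lemma graph_char_poly_rooted_power:
  assumes G: "pair_graph G" and r: "r \<in> pverts G" and a: "a \<ge> 1"
  defines "R \<equiv> graph_char_poly (del_verts G {r})"
  defines "P \<equiv> rooted_power G r a"
  shows "graph_char_poly (del_verts P {rooted_power_root r}) = R ^ a" (is ?del)
    and "graph_char_poly P - [:0, 1:] * graph_char_poly (del_verts P {rooted_power_root r})
       = of_nat a * (graph_char_poly G - [:0, 1:] * R) * R ^ (a - 1)" (is ?root)
proof -
  define f where "f c x = (if x = r then rooted_power_root r else (c, x))" for c :: nat and x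
  define B where "B c = Pair c ` (pverts G - {r})" for c :: nat
  let ?w = "rooted_power_root r"
  let ?M = "graph_kernel P"
  have P: "pair_graph P" unfolding P_def by (rule pair_graph_rooted_power[OF G])
  have fin: "finite (pverts P)" "finite (pverts G)" using P G by (simp_all add: pair_graph_iff)
  have irr: "(x, x) \<notin> parcs G" for x using G by (auto simp: pair_graph_iff irrefl_def)
  have arcs: "parcs P = {(f c x, f c y) | c x y. c < a \<and> (x, y) \<in> parcs G}"
    using map_prod_image_Collect[of "case_prod f" Pair "\<lambda>c x y. c < a \<and> (x, y) \<in> parcs G"]
    by (simp add: P_def f_def[abs_def] rooted_power_def identify_def disjoint_Union_def)
  have verts: "pverts P = {f c x | c x. c < a \<and> x \<in> pverts G}"
    by (simp add: P_def f_def[abs_def] rooted_power_def identify_def disjoint_Union_def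
        image_Sigma_Collect)
  have w: "?w \<notin> B c" for c by (auto simp: B_def rooted_power_root_def)
  have fB: "f c ` pverts G = insert ?w (B c)" "f c ` (pverts G - {r}) = B c" for c
    using r by (auto simp: f_def B_def image_iff)
  have vB: "pverts P = insert ?w (\<Union>c\<in>{..<a}. B c)"
  proof -
    have "0 \<in> {..<a}" using a by simp
    have "pverts P = (\<Union>c\<in>{..<a}. f c ` pverts G)" unfolding verts by auto
    also have "\<dots> = insert ?w (\<Union>c\<in>{..<a}. B c)" using \<open>0 \<in> {..<a}\<close> unfolding fB by blast
    finally show ?thesis .
  qed
  have inj: "inj_on (f c) (pverts G)" for c
    by (auto simp: inj_on_def f_def rooted_power_root_def split: if_splits)
  \<comment> \<open>Away from the root \<open>f\<close> loses neither the copy number nor the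
    vertex; at the root it forgets only the copy number.\<close>
  have f_eq: "c = d \<and> x = y" if "f c x = f d y" "x \<noteq> r" for c d x y
    using that by (auto simp: f_def rooted_power_root_def split: if_splits)
  have f_eq_r: "y = r" if "f c r = f d y" for c d y
    using that by (auto simp: f_def rooted_power_root_def split: if_splits)
  have emb: "(f c x, f c y) \<in> parcs P \<longleftrightarrow> (x, y) \<in> parcs G" if "c < a" for c x y
  proof
    assume "(f c x, f c y) \<in> parcs P"
    then obtain d x' y' where d: "f c x = f d x'" "f c y = f d y'" "(x', y') \<in> parcs G"
      unfolding arcs by auto
    \<comment> \<open>The arc may come from another copy \<open>d\<close>, but it is enough that the
      vertices of \<open>G\<close> agree, since every copy has the same arcs.\<close>
    have "x = x'" using f_eq[OF d(1)] f_eq_r[of c d x'] d(1) by (cases "x = r") auto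
    moreover have "y = y'" using f_eq[OF d(2)] f_eq_r[of c d y'] d(2) by (cases "y = r") auto
    ultimately show "(x, y) \<in> parcs G" using d(3) by simp
  qed (use that arcs in blast)
  have zero: "?M p q = 0" if cd: "c \<noteq> d" and p: "p \<in> B c" and q: "q \<in> B d" for c d p q
  proof (rule graph_kernel_eq_0)
    show "p \<noteq> q" using that by (auto simp: B_def)
    show "(p, q) \<notin> parcs P"
      using that by (auto simp: arcs B_def f_def rooted_power_root_def split: if_splits)
  qed
  have disj: "B c \<inter> B d = {}" if "c \<noteq> d" for c d using that by (auto simp: B_def)
  have finB: "finite (B c)" for c using fin by (simp add: B_def)
  have RB: "set_det (B c) ?M = R" if "c < a" for c
  proof -
    have "set_det (f c ` (pverts G - {r})) ?M = set_det (pverts G - {r}) (graph_kernel G)"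
      by (rule set_det_graph_embedding) (use fin inj emb that in \<open>auto simp: inj_on_def\<close>)
    then show ?thesis by (simp add: fB R_def graph_char_poly_del_verts fin)
  qed
  have QB: "rooted_det (insert ?w (B c)) ?w ?M = graph_char_poly G - [:0, 1:] * R" if "c < a" for c
  proof -
    have "rooted_det (f c ` pverts G) (f c r) ?M = graph_char_poly G - [:0, 1:] * R"
      unfolding R_def
      by (rule rooted_det_graph_embedding) (use G P r inj emb that in auto)
    then show ?thesis by (simp only: fB) (simp add: f_def)
  qed
  have "graph_char_poly (del_verts P {?w}) = set_det (\<Union>c\<in>{..<a}. B c) ?M"
    unfolding graph_char_poly_del_verts[OF fin(1)] vB using w by simp
  also have "\<dots> = (\<Prod>c<a. set_det (B c) ?M)"
    by (rule set_det_disjoint_UN) (auto simp: finB disj zero)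
  finally show ?del by (simp add: RB)
  have "rooted_det (pverts P) ?w ?M
      = (\<Sum>c<a. rooted_det (insert ?w (B c)) ?w ?M * (\<Prod>d\<in>{..<a} - {c}. set_det (B d) ?M))"
    unfolding vB by (rule rooted_det_star) (auto simp: finB disj zero w)
  also have "\<dots> = (\<Sum>c<a. (graph_char_poly G - [:0, 1:] * R) * R ^ (a - 1))"
    by (rule sum.cong) (simp_all add: QB RB)
  finally show ?root
    by (simp add: rooted_det_graph_kernel[OF P] mult.assoc)
qed

text \<open>An instance of \<open>set_det_coalescence\<close>: \<open>A\<close> is the copy of
  \<open>T\<close>, \<open>w i\<close> the merged vertex and \<open>B i\<close> the copy of
  \<open>H i\<close> without \<open>v i\<close>. The rest checks that these pieces are induced
  copies with no further arcs between them.\<close>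

lemma graph_char_poly_coalescence:
  fixes H :: "'i \<Rightarrow> 'b pair_pre_digraph"
  assumes T: "pair_graph T" and I: "finite I"
    and u: "u ` I \<subseteq> pverts T" "inj_on u I"
    and H: "\<And>i. i \<in> I \<Longrightarrow> pair_graph (H i)" and v: "\<And>i. i \<in> I \<Longrightarrow> v i \<in> pverts (H i)"
  shows "graph_char_poly (coalescence T I u H v) =
      (\<Sum>S\<in>Pow I. graph_char_poly (del_verts T (u ` S))
        * (\<Prod>i\<in>S. graph_char_poly (H i) - [:0, 1:] * graph_char_poly (del_verts (H i) {v i}))
        * (\<Prod>i\<in>I - S. graph_char_poly (del_verts (H i) {v i})))"
proof -
  define C where "C = coalescence T I u H v"
  define g where "g i x = (if x = v i then Inl (u i) else Inr (i, x))" for i x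
  define A where "A = (Inl ` pverts T :: ('a + 'i \<times> 'b) set)"
  define B where "B i = (\<lambda>x. Inr (i, x) :: 'a + 'i \<times> 'b) ` (pverts (H i) - {v i})" for i
  define w where "w i = (Inl (u i) :: 'a + 'i \<times> 'b)" for i
  let ?M = "graph_kernel C"
  let ?f = "case_sum Inl (case_prod g)"
  have C: "pair_graph C" unfolding C_def by (rule pair_graph_coalescence[OF T I H])
  have fin: "finite (pverts C)" "finite (pverts T)" using C T by (simp_all add: pair_graph_iff)
  have finH: "finite (pverts (H i))" if "i \<in> I" for i using H[OF that] by (simp add: pair_graph_iff)
  have irrT: "(x, x) \<notin> parcs T" for x using T by (auto simp: pair_graph_iff irrefl_def)
  have irrH: "(x, x) \<notin> parcs (H i)" if "i \<in> I" for i x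
    using H[OF that] by (auto simp: pair_graph_iff irrefl_def)
  have arcs: "parcs C = map_prod Inl Inl ` parcs T
      \<union> {(g i x, g i y) | i x y. i \<in> I \<and> (x, y) \<in> parcs (H i)}"
  proof -
    have "parcs C = map_prod ?f ?f ` map_prod Inl Inl ` parcs T \<union> map_prod ?f ?f ` map_prod Inr Inr `
        {((i, x), (i, y)) | i x y. i \<in> I \<and> (x, y) \<in> parcs (H i)}"
      by (simp add: C_def g_def[abs_def] coalescence_def identify_def disjoint_union_def
          disjoint_Union_def image_Un)
    also have "map_prod ?f ?f ` map_prod Inl Inl ` parcs T = map_prod Inl Inl ` parcs T"
      by (simp add: image_image map_prod_def split_beta)
    also have "map_prod ?f ?f ` map_prod Inr Inr `
          {((i, x), (i, y)) | i x y. i \<in> I \<and> (x, y) \<in> parcs (H i)}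
        = {(?f (Inr (i, x)), ?f (Inr (i, y))) | i x y. i \<in> I \<and> (x, y) \<in> parcs (H i)}"
      by (simp only: map_prod_image_Collect[where f = Inr and g = Pair]
          map_prod_image_Collect[where f = ?f and g = "\<lambda>i x. Inr (i, x)"])
    finally show ?thesis by simp
  qed
  have gB: "g i ` pverts (H i) = insert (w i) (B i)" "g i ` (pverts (H i) - {v i}) = B i"
    if "i \<in> I" for i
    using v[OF that] by (auto simp: g_def B_def w_def image_iff)
  have verts: "pverts C = A \<union> (\<Union>i\<in>I. B i)"
  proof -
    have "pverts C = ?f ` Inl ` pverts T \<union> ?f ` Inr ` (SIGMA i : I. pverts (H i))"
      unfolding g_def[abs_def] C_def coalescence_def identify_def disjoint_union_def
        disjoint_Union_def by (simp add: Plus_def image_Un)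
    also have "?f ` Inl ` pverts T = A" by (simp add: image_image A_def)
    also have "?f ` Inr ` (SIGMA i : I. pverts (H i)) = (\<Union>i\<in>I. g i ` pverts (H i))"
      by (force simp: image_iff)
    also have "\<dots> = (\<Union>i\<in>I. insert (w i) (B i))" using gB by simp
    finally show ?thesis using u by (auto simp: A_def w_def)
  qed
  have inj: "inj_on (g i) (pverts (H i))" for i by (auto simp: inj_on_def g_def split: if_splits)
  \<comment> \<open>An arc of some \<open>H i\<close> with both ends in the copy of \<open>T\<close>
    would be a loop at \<open>v i\<close>.\<close>
  have embT: "(Inl x, Inl y) \<in> parcs C \<longleftrightarrow> (x, y) \<in> parcs T" for x y
    using irrH by (auto simp: arcs g_def split: if_splits)
  have embH: "(g i x, g i y) \<in> parcs C \<longleftrightarrow> (x, y) \<in> parcs (H i)" if i: "i \<in> I" for i x y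
  proof
    assume "(g i x, g i y) \<in> parcs C"
    then consider s t where "(s, t) \<in> parcs T" "g i x = Inl s" "g i y = Inl t"
      | j x' y' where "j \<in> I" "(x', y') \<in> parcs (H j)" "g i x = g j x'" "g i y = g j y'"
      unfolding arcs by auto
    then show "(x, y) \<in> parcs (H i)"
    proof cases
      \<comment> \<open>Both ends lie in the copy of \<open>T\<close>, so \<open>x\<close> and
        \<open>y\<close> both equal \<open>v i\<close>, and the arc of \<open>T\<close> would be a
        loop at \<open>u i\<close>.\<close>
      case 1
      then show ?thesis using irrT by (auto simp: g_def split: if_splits)
    next
      case 2
      \<comment> \<open>An arc of \<open>H j\<close> is no loop, so one end differs from
        \<open>v j\<close>; that end carries the tag \<open>j\<close>, which forces
        \<open>i = j\<close>.\<close>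
      have "x' \<noteq> v j \<or> y' \<noteq> v j" using 2 irrH by auto
      then have "i = j" using 2 by (auto simp: g_def split: if_splits)
      then show ?thesis using 2 by (auto simp: g_def split: if_splits)
    qed
  qed (use that arcs in blast)
  have RB: "set_det (B i) ?M = graph_char_poly (del_verts (H i) {v i})" if "i \<in> I" for i
  proof -
    have "set_det (g i ` (pverts (H i) - {v i})) ?M
        = set_det (pverts (H i) - {v i}) (graph_kernel (H i))"
      by (rule set_det_graph_embedding) (use finH inj embH that in \<open>auto simp: inj_on_def\<close>)
    then show ?thesis using that by (simp add: gB graph_char_poly_del_verts finH)
  qed
  have QB: "rooted_det (insert (w i) (B i)) (w i) ?M
      = graph_char_poly (H i) - [:0, 1:] * graph_char_poly (del_verts (H i) {v i})"
    if "i \<in> I" for i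
  proof -
    have "rooted_det (g i ` pverts (H i)) (g i (v i)) ?M
      = graph_char_poly (H i) - [:0, 1:] * graph_char_poly (del_verts (H i) {v i})"
      by (rule rooted_det_graph_embedding) (use H C v inj embH that in auto)
    then show ?thesis by (simp only: gB[OF that]) (simp add: g_def w_def)
  qed
  have PA: "set_det (A - w ` S) ?M = graph_char_poly (del_verts T (u ` S))" for S
  proof -
    have "A - w ` S = Inl ` (pverts T - u ` S)" by (auto simp: A_def w_def)
    moreover have "set_det (Inl ` (pverts T - u ` S)) ?M
        = set_det (pverts T - u ` S) (graph_kernel T)"
      by (rule set_det_graph_embedding) (use fin embT in auto)
    ultimately show ?thesis by (simp add: graph_char_poly_del_verts fin)
  qed
  have "graph_char_poly C = set_det (A \<union> (\<Union>i\<in>I. B i)) ?M"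
    unfolding graph_char_poly_eq_set_det[OF fin(1)] verts ..
  also have "\<dots> = (\<Sum>S\<in>Pow I. set_det (A - w ` S) ?M
      * (\<Prod>i\<in>S. rooted_det (insert (w i) (B i)) (w i) ?M) * (\<Prod>i\<in>I - S. set_det (B i) ?M))"
  proof (rule set_det_coalescence[OF I])
    show "inj_on w I" using u by (simp add: inj_on_def w_def)
    show "?M x y = 0" if "i \<noteq> j" "x \<in> B i" "y \<in> B j" for i j x y
      by (rule graph_kernel_eq_0) (use that in \<open>auto simp: arcs B_def g_def split: if_splits\<close>)
    show "?M x y = 0 \<and> ?M y x = 0" if "x \<in> A - {w i}" "y \<in> B i" for i x y
      by (intro conjI graph_kernel_eq_0)
        (use that in \<open>auto simp: arcs A_def B_def w_def g_def split: if_splits\<close>)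
  qed (use fin finH u in \<open>auto simp: A_def B_def w_def\<close>)
  also have "\<dots> = (\<Sum>S\<in>Pow I. graph_char_poly (del_verts T (u ` S))
        * (\<Prod>i\<in>S. graph_char_poly (H i) - [:0, 1:] * graph_char_poly (del_verts (H i) {v i}))
        * (\<Prod>i\<in>I - S. graph_char_poly (del_verts (H i) {v i})))"
  proof (intro sum.cong refl arg_cong2[of _ _ _ _ "(*)"] PA)
    fix S assume "S \<in> Pow I"
    then show "(\<Prod>i\<in>S. rooted_det (insert (w i) (B i)) (w i) ?M) = (\<Prod>i\<in>S. graph_char_poly (H i)
        - [:0, 1:] * graph_char_poly (del_verts (H i) {v i}))"
      by (intro prod.cong refl QB) auto
  qed (intro prod.cong refl RB, simp)
  finally show ?thesis by (simp add: C_def)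
qed

section \<open>Substituting rooted powers into the coalescence formula\<close>

theorem theorem1:
  fixes T :: "'a pair_pre_digraph" and k :: nat and u :: "nat \<Rightarrow> 'a"
    and G :: "nat \<Rightarrow> 'b pair_pre_digraph" and r :: "nat \<Rightarrow> 'b"
    and a :: "nat \<Rightarrow> nat" and Q R :: "nat \<Rightarrow> int poly"
  assumes "k \<ge> 1"
    and "pair_graph T"
    and "u ` {1..k} \<subseteq> pverts T" and "inj_on u {1..k}"
    and "\<And>i. i \<in> {1..k} \<Longrightarrow> pair_graph (G i)"
    and "\<And>i. i \<in> {1..k} \<Longrightarrow> r i \<in> pverts (G i)"
    and "\<And>i. i \<in> {1..k} \<Longrightarrow>
           Q i = graph_char_poly (G i) - [:0, 1:] * graph_char_poly (del_verts (G i) {r i})"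
    and "\<And>i. i \<in> {1..k} \<Longrightarrow> R i = graph_char_poly (del_verts (G i) {r i})"
    and "\<And>i. i \<in> {1..k} \<Longrightarrow> a i \<ge> 1"
  shows "graph_char_poly
           (coalescence T {1..k} u
             (\<lambda>i. rooted_power (G i) (r i) (a i)) (\<lambda>i. rooted_power_root (r i))) =
         (\<Sum>I\<in>Pow {1..k}. graph_char_poly (del_verts T (u ` I)) *
            (\<Prod>j\<in>I. of_nat (a j)) * (\<Prod>l\<in>I. Q l) * (\<Prod>m=1..k. R m ^ (a m - card ({m} \<inter> I))))"
proof -
  let ?P = "\<lambda>i. rooted_power (G i) (r i) (a i)" and ?w = "\<lambda>i. rooted_power_root (r i)"
  let ?R = "\<lambda>i. graph_char_poly (del_verts (?P i) {?w i})"
  let ?Q = "\<lambda>i. graph_char_poly (?P i) - [:0, 1:] * ?R i"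
  have R: "?R i = R i ^ a i" if "i \<in> {1..k}" for i
    using graph_char_poly_rooted_power(1)[OF assms(5,6,9)[OF that]] assms(8)[OF that] by simp
  have Q: "?Q i = of_nat (a i) * Q i * R i ^ (a i - 1)" if "i \<in> {1..k}" for i
    using graph_char_poly_rooted_power(2)[OF assms(5,6,9)[OF that]] assms(7,8)[OF that] by simp
  have "graph_char_poly (coalescence T {1..k} u ?P ?w) =
      (\<Sum>I\<in>Pow {1..k}. graph_char_poly (del_verts T (u ` I)) * (\<Prod>i\<in>I. ?Q i) * (\<Prod>i\<in>{1..k} - I. ?R i))"
    using assms
    by (intro graph_char_poly_coalescence pair_graph_rooted_power rooted_power_root_in_pverts) auto
  also have "\<dots> = (\<Sum>I\<in>Pow {1..k}. graph_char_poly (del_verts T (u ` I)) *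
      (\<Prod>j\<in>I. of_nat (a j)) * (\<Prod>l\<in>I. Q l) * (\<Prod>m=1..k. R m ^ (a m - card ({m} \<inter> I))))"
  proof (rule sum.cong[OF refl])
    fix I assume "I \<in> Pow {1..k}"
    then have I: "I \<subseteq> {1..k}" by simp
    \<comment> \<open>The exponent is \<open>a m\<close> off \<open>I\<close> and
      \<open>a m - 1\<close> on \<open>I\<close>; as \<open>a m\<close> is at least 1, the
      subtraction of naturals does not truncate. The factors off \<open>I\<close> are the
      \<open>?R m\<close>; those on \<open>I\<close> are the powers contained in
      \<open>?Q m\<close>.\<close>
    have "(\<Prod>m=1..k. R m ^ (a m - card ({m} \<inter> I)))
        = (\<Prod>m\<in>{1..k} - I. R m ^ (a m - card ({m} \<inter> I))) * (\<Prod>m\<in>I. R m ^ (a m - card ({m} \<inter> I)))"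
      by (rule prod.subset_diff[OF I]) simp
    also have "(\<Prod>m\<in>{1..k} - I. R m ^ (a m - card ({m} \<inter> I))) = (\<Prod>m\<in>{1..k} - I. ?R m)"
      using R by (intro prod.cong) auto
    also have "(\<Prod>m\<in>I. R m ^ (a m - card ({m} \<inter> I))) = (\<Prod>m\<in>I. R m ^ (a m - 1))"
      by (intro prod.cong) auto
    finally have "(\<Prod>m=1..k. R m ^ (a m - card ({m} \<inter> I)))
        = (\<Prod>m\<in>{1..k} - I. ?R m) * (\<Prod>m\<in>I. R m ^ (a m - 1))" .
    moreover have "(\<Prod>i\<in>I. ?Q i) = (\<Prod>i\<in>I. of_nat (a i) * Q i * R i ^ (a i - 1))"
      by (intro prod.cong refl Q) (use I in auto)
    ultimately show "graph_char_poly (del_verts T (u ` I)) * (\<Prod>i\<in>I. ?Q i) * (\<Prod>i\<in>{1..k} - I. ?R i)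
      = graph_char_poly (del_verts T (u ` I)) * (\<Prod>j\<in>I. of_nat (a j)) * (\<Prod>l\<in>I. Q l)
          * (\<Prod>m=1..k. R m ^ (a m - card ({m} \<inter> I)))"
      by (simp add: prod.distrib mult_ac)
  qed
  finally show ?thesis .
qed

end
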